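(* Let $V$ be a vertex superalgebra of countable dimension over $\mathbb{C}$, let $G\le \mathrm{Aut}(V)$ be a finite subgroup (not necessarily abelian), and let $h\in Z(G)$, where $Z(G)$ is the center of $G$. Let $M$ be an irreducible weak $h$-twisted $V$-module such that $M\not\cong g\circ M$ for all $g\in G\setminus\{1\}$. Then $M$ is also irreducible as a $V^G$-module.
   Context: All spaces are over $\mathbb{C}$. A vertex superalgebra $(V,\mathbf 1,D,Y)$, $V=V_{\bar 0}\oplus V_{\bar 1}$, is defined by the usual axioms (truncation, $D$-derivative property, vacuum, creation, and the super Jacobi identity with sign $(-1)^{|u||v|}$). An automorphism of $V$ is a linear automorphism $g$ of $V$ with $gY(v,z)g^{-1}=Y(gv,z)$ for all $v\in V$; $\mathrm{Aut}(V)$ is the group of automorphisms, and $V^G=\{v\in V: gv=v\ \forall g\in G\}$. Weak twisted modules: let $g\in\mathrm{Aut}(V)$ have finite order $T$, and fix a primitive $T$-th root of unity $\eta$; $V=\bigoplus_{j\in\mathbb{Z}/T\mathbb{Z}}V^j$ with $V^j=\{v: gv=\eta^jv\}$. A weak $g$-twisted $V$-module is a vector space $M$ (not required to be $\mathbb{Z}_2$-graded) with a linear map $v\mapsto Y_g(v,z)=\sum_{n\in\frac1T\mathbb{Z}}v_nz^{-n-1}\in(\mathrm{End}\,M)[[z^{1/T},z^{-1/T}]]$ such that: $v_nw=0$ for $n$ sufficiently large (for each $v\in V$, $w\in M$); $Y_g(\mathbf 1,z)=\mathrm{Id}_M$; and for parity-homogeneous $u,v\in V$, $$z_0^{-1}\delta\Big(\tfrac{z_1-z_2}{z_0}\Big)Y_g(u,z_1)Y_g(v,z_2)-(-1)^{|u||v|}z_0^{-1}\delta\Big(\tfrac{z_2-z_1}{-z_0}\Big)Y_g(v,z_2)Y_g(u,z_1)=\frac{z_2^{-1}}{T}\sum_{j\in\mathbb{Z}/T\mathbb{Z}}\delta\Big(\eta^j\tfrac{(z_1-z_0)^{1/T}}{z_2^{1/T}}\Big)Y_g(Y(g^ju,z_0)v,z_2).$$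 A submodule is a subspace stable under all $v_n$; a module is irreducible if it is nonzero and has no nonzero proper submodule; an isomorphism is a linear bijection intertwining all operators $v_n$. For a weak $h$-twisted module $(M,Y_M)$ and $g\in \mathrm{Aut}(V)$ commuting with $h$, the weak $h$-twisted module $g\circ M$ is $M$ as a vector space with $Y_{g\circ M}(v,z)=Y_M(g^{-1}v,z)$. Irreducibility of $M$ as a $V^G$-module means that $M\neq0$ has no nonzero proper subspace stable under all modes $v_n$ with $v\in V^G$. *)

theory Defs
  imports
    Complex_Main
    "HOL-Library.Countable_Set"
    "HOL-Library.Groups_Big_Fun"
    "HOL-Library.Z2"
    "HOL-Algebra.Multiplicative_Group"
begin

text \<open>
  Vector spaces over the complex numbers are given by a type together with a scalar multiplication.
  A vertex operator is given by its modes: for a vertex superalgebra,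
  \<open>Y v n\<close> is the coefficient of \<open>z^(-n-1)\<close> in \<open>Y(v,z)\<close>.  Identities of formal
  series are stated coefficientwise, and \<open>Sum_any\<close> is the sum over the (finite) support.
\<close>

definition countable_dimension :: "(complex \<Rightarrow> 'v::ab_group_add \<Rightarrow> 'v) \<Rightarrow> bool" where
  "countable_dimension scale \<longleftrightarrow>
     (\<exists>B. countable B \<and> \<not> Modules.module.dependent scale B \<and> Modules.module.span scale B = UNIV)"

text \<open>The sign \<open>(-1)^(|u||v|)\<close> for parities \<open>|u| = p\<close>, \<open>|v| = q\<close>.\<close>

definition parity_sign :: "bit \<Rightarrow> bit \<Rightarrow> complex" where
  "parity_sign p q = (if p * q = 1 then -1 else 1)"

text \<open>
  In \<open>jacobi\<close> the coefficients of \<open>z0^(-l-1) z1^(-m-1) z2^(-n-1)\<close> in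
  \<open>z0^(-1) delta((z1-z2)/z0) Y(u,z1) Y(v,z2)
    - (-1)^(|u||v|) z0^(-1) delta((z2-z1)/(-z0)) Y(v,z2) Y(u,z1)
    = z2^(-1) delta((z1-z0)/z2) Y(Y(u,z0)v,z2)\<close>
  are compared.  Powers of binomials are expanded in nonnegative powers of the second variable.  On the
  right-hand side the relevant terms are \<open>(z1-z0)^k z2^(-k-1)\<close> with \<open>k = i-m-1\<close>, where the
  coefficient of \<open>z0^i\<close> is \<open>(-1)^i (k gchoose i) = m gchoose i\<close>.
\<close>

locale vertex_superalgebra = V: vector_space scaleV
  for scaleV :: "complex \<Rightarrow> 'v::ab_group_add \<Rightarrow> 'v" +
  fixes part :: "bit \<Rightarrow> 'v set"
    and vac :: 'v
    and D :: "'v \<Rightarrow> 'v"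
    and Y :: "'v \<Rightarrow> int \<Rightarrow> 'v \<Rightarrow> 'v"
  assumes part_subspace: "V.subspace (part p)"
    and part_decomp: "\<exists>a\<in>part 0. \<exists>b\<in>part 1. v = a + b"
    and part_direct: "part 0 \<inter> part 1 = {0}"
    and vac_even: "vac \<in> part 0"
    and D_linear: "Vector_Spaces.linear scaleV scaleV D"
    and Y_linear_left: "Vector_Spaces.linear scaleV scaleV (\<lambda>u. Y u n v)"
    and Y_linear_right: "Vector_Spaces.linear scaleV scaleV (Y u n)"
    and Y_parity: "u \<in> part p \<Longrightarrow> v \<in> part q \<Longrightarrow> Y u n v \<in> part (p + q)"
    and truncation: "\<exists>N. \<forall>n\<ge>N. Y u n v = 0"
    and D_derivative: "Y (D u) n v = scaleV (- of_int n) (Y u (n - 1) v)"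
    and D_bracket: "D (Y u n v) - Y u n (D v) = scaleV (- of_int n) (Y u (n - 1) v)"
    and vacuum: "Y vac n v = (if n = -1 then v else 0)"
    and creation: "n \<ge> 0 \<Longrightarrow> Y v n vac = 0" "Y v (-1) vac = v"
    and jacobi: "u \<in> part p \<Longrightarrow> v \<in> part q \<Longrightarrow>
      Sum_any (\<lambda>i::nat. scaleV ((-1) ^ i * (of_int l gchoose i))
        (Y u (m + l - int i) (Y v (n + int i) w)))
      - scaleV (parity_sign p q) (Sum_any (\<lambda>i::nat. scaleV ((-1) powi l * (-1) ^ i * (of_int l gchoose i))
        (Y v (n + l - int i) (Y u (m + int i) w))))
      = Sum_any (\<lambda>i::nat. scaleV (of_int m gchoose i)
        (Y (Y u (l + int i) v) (m + n - int i) w))"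

text \<open>Automorphisms are not required to preserve parity.\<close>

definition Aut :: "(complex \<Rightarrow> 'v::ab_group_add \<Rightarrow> 'v) \<Rightarrow> ('v \<Rightarrow> int \<Rightarrow> 'v \<Rightarrow> 'v) \<Rightarrow> ('v \<Rightarrow> 'v) monoid" where
  "Aut scaleV Y =
    \<lparr>carrier = {g. Vector_Spaces.linear scaleV scaleV g \<and> bij g \<and>
                   (\<forall>v n. g \<circ> Y v n \<circ> inv_into UNIV g = Y (g v) n)},
     monoid.mult = (\<circ>), one = id\<rparr>"

lemma group_Aut:
  assumes "vector_space scaleV"
  shows "group (Aut scaleV Y)"
proof (rule groupI)
  interpret V: vector_space scaleV by fact
  show "\<one>\<^bsub>Aut scaleV Y\<^esub> \<in> carrier (Aut scaleV Y)"
    using V.linear_id by (auto simp: Aut_def id_def[symmetric] inv_id)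
  show "x \<otimes>\<^bsub>Aut scaleV Y\<^esub> y \<in> carrier (Aut scaleV Y)"
    if "x \<in> carrier (Aut scaleV Y)" "y \<in> carrier (Aut scaleV Y)" for x y
    using that by (auto simp: Aut_def bij_comp Vector_Spaces.linear_compose o_inv_distrib fun_eq_iff)
  show "\<exists>y\<in>carrier (Aut scaleV Y). y \<otimes>\<^bsub>Aut scaleV Y\<^esub> x = \<one>\<^bsub>Aut scaleV Y\<^esub>"
    if x: "x \<in> carrier (Aut scaleV Y)" for x
  proof
    have lin: "Vector_Spaces.linear scaleV scaleV x" and b: "bij x"
      and c: "\<And>v n. x \<circ> Y v n \<circ> inv_into UNIV x = Y (x v) n"
      using x by (auto simp: Aut_def)
    have "Vector_Spaces.linear scaleV scaleV (inv_into UNIV x)"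
      unfolding Vector_Spaces.linear_iff
    proof (intro conjI allI)
      show "inv_into UNIV x (a + b') = inv_into UNIV x a + inv_into UNIV x b'" for a b'
        by (rule inv_f_eq)
          (use b lin in \<open>simp_all add: bij_is_inj Vector_Spaces.linear_iff bij_is_surj surj_f_inv_f\<close>)
      show "inv_into UNIV x (scaleV r a) = scaleV r (inv_into UNIV x a)" for r a
        by (rule inv_f_eq)
          (use b lin in \<open>simp_all add: bij_is_inj Vector_Spaces.linear_iff bij_is_surj surj_f_inv_f\<close>)
    qed (fact assms)+
    moreover have "inv_into UNIV x \<circ> Y v n \<circ> inv_into UNIV (inv_into UNIV x) = Y (inv_into UNIV x v) n" for v n
    proof -
      have "Y v n = x \<circ> Y (inv_into UNIV x v) n \<circ> inv_into UNIV x"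
        using b by (simp add: c bij_is_surj surj_f_inv_f)
      then show ?thesis
        using b by (simp add: inv_inv_eq fun_eq_iff bij_is_inj)
    qed
    ultimately show "inv_into UNIV x \<in> carrier (Aut scaleV Y)"
      using b by (simp add: Aut_def bij_imp_bij_inv)
    show "inv_into UNIV x \<otimes>\<^bsub>Aut scaleV Y\<^esub> x = \<one>\<^bsub>Aut scaleV Y\<^esub>"
      using b by (simp add: Aut_def bij_is_inj)
  qed
qed (auto simp: Aut_def)

definition fixed_points :: "('v \<Rightarrow> 'v) set \<Rightarrow> 'v set" where
  "fixed_points G = {v. \<forall>g\<in>G. g v = v}"

definition center :: "('v \<Rightarrow> 'v) set \<Rightarrow> ('v \<Rightarrow> 'v) set" where
  "center G = {h \<in> G. \<forall>g\<in>G. g \<circ> h = h \<circ> g}"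

definition primitive_root_of_unity :: "nat \<Rightarrow> complex \<Rightarrow> bool" where
  "primitive_root_of_unity T \<eta> \<longleftrightarrow> T > 0 \<and> \<eta> ^ T = 1 \<and> (\<forall>k. 0 < k \<and> k < T \<longrightarrow> \<eta> ^ k \<noteq> 1)"

text \<open>
  Modes of \<open>YM v\<close> are indexed by rational numbers and supported in \<open>(1/T)\<int>\<close>.
  In \<open>twisted_jacobi\<close> the coefficients of \<open>z0^(-l-1) z1^(-m-1) z2^(-n-1)\<close> are compared, with
  \<open>m = a/T\<close> and \<open>n = b/T\<close>.  On the right-hand side the relevant terms of the delta functions
  are \<open>\<eta>^(j k) (z1-z0)^(k/T) z2^(-k/T)\<close> with \<open>k/T = i-m-1\<close>, so that
  \<open>\<eta>^(j k) = \<eta>^(-j a)\<close> and the coefficient of \<open>z0^i\<close> is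
  \<open>(-1)^i (k/T gchoose i) = m gchoose i\<close>.
\<close>

locale weak_twisted_module =
  vertex_superalgebra scaleV part vac D Y + M: vector_space scaleM
  for scaleV :: "complex \<Rightarrow> 'v::ab_group_add \<Rightarrow> 'v" and part vac D Y
    and scaleM :: "complex \<Rightarrow> 'm::ab_group_add \<Rightarrow> 'm" +
  fixes h :: "'v \<Rightarrow> 'v"
    and T :: nat
    and \<eta> :: complex
    and YM :: "'v \<Rightarrow> rat \<Rightarrow> 'm \<Rightarrow> 'm"
  assumes twist_aut: "h \<in> carrier (Aut scaleV Y)"
    and twist_order: "T = group.ord (Aut scaleV Y) h" "T > 0"
    and primitive_root: "primitive_root_of_unity T \<eta>"
    and YM_linear_left: "Vector_Spaces.linear scaleV scaleM (\<lambda>v. YM v n w)"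
    and YM_linear_right: "Vector_Spaces.linear scaleM scaleM (YM v n)"
    and YM_support: "of_nat T * n \<notin> \<int> \<Longrightarrow> YM v n w = 0"
    and YM_truncation: "\<exists>N. \<forall>n\<ge>N. YM v n w = 0"
    and YM_vacuum: "YM vac n w = (if n = -1 then w else 0)"
    and twisted_jacobi: "u \<in> part p \<Longrightarrow> v \<in> part q \<Longrightarrow>
      m = of_int a / of_nat T \<Longrightarrow> n = of_int b / of_nat T \<Longrightarrow>
      Sum_any (\<lambda>i::nat. scaleM ((-1) ^ i * (of_int l gchoose i))
        (YM u (m + of_int l - of_nat i) (YM v (n + of_nat i) w)))
      - scaleM (parity_sign p q) (Sum_any (\<lambda>i::nat. scaleM ((-1) powi l * (-1) ^ i * (of_int l gchoose i))
        (YM v (n + of_int l - of_nat i) (YM u (m + of_nat i) w))))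
      = scaleM (1 / of_nat T) (\<Sum>j<T. scaleM (\<eta> powi (- (int j * a)))
          (Sum_any (\<lambda>i::nat. scaleM (of_rat m gchoose i)
            (YM (Y ((h ^^ j) u) (l + int i) v) (m + n - of_nat i) w))))"

text \<open>
  Irreducibility under the modes of the vectors in \<open>S\<close>: the whole algebra \<open>S = UNIV\<close> for
  \<open>V\<close>-modules, and \<open>S = fixed_points G\<close> for the restriction to the fixed-point subalgebra.
\<close>

definition irreducible_under ::
  "(complex \<Rightarrow> 'm::ab_group_add \<Rightarrow> 'm) \<Rightarrow> ('v \<Rightarrow> rat \<Rightarrow> 'm \<Rightarrow> 'm) \<Rightarrow> 'v set \<Rightarrow> bool" where
  "irreducible_under scaleM YM S \<longleftrightarrow>
     (\<exists>x::'m. x \<noteq> 0) \<and>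
     (\<forall>W. Modules.module.subspace scaleM W \<and> (\<forall>v\<in>S. \<forall>n. \<forall>w\<in>W. YM v n w \<in> W) \<longrightarrow> W = {0} \<or> W = UNIV)"

definition isomorphic_modules ::
  "(complex \<Rightarrow> 'm::ab_group_add \<Rightarrow> 'm) \<Rightarrow> ('v \<Rightarrow> rat \<Rightarrow> 'm \<Rightarrow> 'm) \<Rightarrow>
   (complex \<Rightarrow> 'n::ab_group_add \<Rightarrow> 'n) \<Rightarrow> ('v \<Rightarrow> rat \<Rightarrow> 'n \<Rightarrow> 'n) \<Rightarrow> bool" where
  "isomorphic_modules scaleM YM scaleN YN \<longleftrightarrow>
     (\<exists>f. Vector_Spaces.linear scaleM scaleN f \<and> bij f \<and> (\<forall>v n w. f (YM v n w) = YN v n (f w)))"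

text \<open>The modes of \<open>g \<circ> M\<close>; the underlying vector space is that of \<open>M\<close>.\<close>

definition conjugate_action :: "('v \<Rightarrow> 'v) \<Rightarrow> ('v \<Rightarrow> rat \<Rightarrow> 'm \<Rightarrow> 'm) \<Rightarrow> 'v \<Rightarrow> rat \<Rightarrow> 'm \<Rightarrow> 'm" where
  "conjugate_action g YM = (\<lambda>v. YM (inv_into UNIV g v))"

end

theory Submission
  imports Defs
begin

text \<open>
  Fix a nonzero \<open>w\<close> in a subspace \<open>W\<close> that is stable under the modes of \<open>V^G\<close>, and let \<open>V\<close> act
  on the product of the conjugates \<open>g \<circ> M\<close>, one factor for each \<open>g \<in> G\<close>.  Inside the product
  stands the span \<open>S\<close> of the vectors \<open>u_n (w, ..., w) = ((g^(-1) u)_n w)_g\<close>.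

  The span \<open>S\<close> is already stable under all modes, although it uses only one mode at a time.  This
  is associativity: a product of two modes, applied to a given vector, is a combination of single
  modes of the vectors \<open>(h^j u)_l v\<close>.  The coefficients and the vectors do not depend on \<open>g\<close>, because
  \<open>h\<close> commutes with \<open>g\<close> and only finitely many \<open>g\<close> occur
  (\<open>weak_associativity\<close>, \<open>diagonal_submodule_act_generator\<close>).

  The factors are irreducible and pairwise non-isomorphic, and \<open>S\<close> contains \<open>(w, ..., w)\<close>.  A
  Goursat argument therefore puts every vector of the form \<open>(x, 0, ..., 0)\<close>, with \<open>x\<close> at the
  identity, into \<open>S\<close> (\<open>product_submodule_separates\<close>).

  Finally, adding up the coordinates of a vector of \<open>S\<close> replaces each \<open>u\<close> by the sum of the
  \<open>g^(-1) u\<close>, which is fixed by \<open>G\<close>.  So the coordinate sum lies in \<open>W\<close>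
  (\<open>coordinate_sum_in_fixed_submodule\<close>); for \<open>(x, 0, ..., 0)\<close> this says \<open>x \<in> W\<close>.
\<close>

section \<open>Submodules of products of irreducible modules\<close>

text \<open>
  The factors \<open>\<rho> i\<close> share one underlying vector space, so elements of the product are functions of
  the index.
\<close>

definition product_submodule ::
  "(complex \<Rightarrow> 'm::ab_group_add \<Rightarrow> 'm) \<Rightarrow> ('i \<Rightarrow> 'v \<Rightarrow> rat \<Rightarrow> 'm \<Rightarrow> 'm) \<Rightarrow> ('i \<Rightarrow> 'm) set \<Rightarrow> bool" where
  "product_submodule scaleM \<rho> S \<longleftrightarrow>
     (\<lambda>i. 0) \<in> S \<and>
     (\<forall>f\<in>S. \<forall>g\<in>S. (\<lambda>i. f i + g i) \<in> S) \<and>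
     (\<forall>c. \<forall>f\<in>S. (\<lambda>i. scaleM c (f i)) \<in> S) \<and>
     (\<forall>v n. \<forall>f\<in>S. (\<lambda>i. \<rho> i v n (f i)) \<in> S)"

lemma irreducible_under_cases:
  assumes "irreducible_under scaleM \<rho> S" "Modules.module.subspace scaleM W"
    and "\<And>v n w. v \<in> S \<Longrightarrow> w \<in> W \<Longrightarrow> \<rho> v n w \<in> W"
  shows "W = {0} \<or> W = UNIV"
  using assms unfolding irreducible_under_def by blast

locale complex_vector_space = vector_space scale
  for scale :: "complex \<Rightarrow> 'm::ab_group_add \<Rightarrow> 'm"
begin

text \<open>The values at \<open>k\<close> form a nonzero submodule of the irreducible \<open>k\<close>-th factor.\<close>

lemma product_submodule_projection_surj:
  assumes S: "product_submodule scale \<rho> S"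
    and irr: "irreducible_under scale (\<rho> k) UNIV"
    and nz: "\<exists>f\<in>S. f k \<noteq> 0"
  shows "\<exists>f\<in>S. f k = x"
proof -
  let ?W = "(\<lambda>f. f k) ` S"
  have "subspace ?W"
  proof (rule subspaceI)
    show "0 \<in> ?W"
      using S unfolding product_submodule_def by force
    show "x + y \<in> ?W" if xy: "x \<in> ?W" "y \<in> ?W" for x y
    proof -
      obtain f g where "f \<in> S" "g \<in> S" "x = f k" "y = g k"
        using xy by blast
      moreover from this have "(\<lambda>i. f i + g i) \<in> S"
        using S unfolding product_submodule_def by blast
      ultimately show ?thesis by force
    qed
    show "scale c x \<in> ?W" if x: "x \<in> ?W" for c x
    proof -
      obtain f where "f \<in> S" "x = f k"
        using x by blast
      moreover from this have "(\<lambda>i. scale c (f i)) \<in> S"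
        using S unfolding product_submodule_def by blast
      ultimately show ?thesis by force
    qed
  qed
  moreover have "\<rho> k v n x \<in> ?W" if x: "x \<in> ?W" for v n x
  proof -
    obtain f where "f \<in> S" "x = f k"
      using x by blast
    moreover from this have "(\<lambda>i. \<rho> i v n (f i)) \<in> S"
      using S unfolding product_submodule_def by blast
    ultimately show ?thesis by force
  qed
  ultimately have "?W = {0} \<or> ?W = UNIV"
    by (intro irreducible_under_cases[OF irr])
  with nz have "?W = UNIV" by auto
  then have "x \<in> ?W" by simp
  then show ?thesis by blast
qed

text \<open>
  This is Goursat's lemma for two factors.  If a submodule had no element that vanishes at \<open>j\<close>
  but not at \<open>k\<close>, then its elements would be determined at \<open>k\<close> by their value at \<open>j\<close>.  The
  submodule would be the graph of a surjective homomorphism from the \<open>j\<close>-th to the \<open>k\<close>-th factor,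
  and irreducibility of the \<open>j\<close>-th factor would make this an isomorphism.
\<close>

lemma product_submodule_separates_two:
  assumes S: "product_submodule scale \<rho> S"
    and lin: "\<And>v n. Vector_Spaces.linear scale scale (\<rho> k v n)"
    and irr: "irreducible_under scale (\<rho> j) UNIV" "irreducible_under scale (\<rho> k) UNIV"
    and noniso: "\<not> isomorphic_modules scale (\<rho> j) scale (\<rho> k)"
    and nz: "\<exists>f\<in>S. f j \<noteq> 0" "\<exists>f\<in>S. f k \<noteq> 0"
  shows "\<exists>f\<in>S. f k \<noteq> 0 \<and> f j = 0"
proof (rule ccontr)
  assume "\<not> ?thesis"
  \<comment> \<open>Under this assumption \<open>S\<close> is the graph of a homomorphism \<open>\<phi>\<close> on its \<open>j\<close>-th and \<open>k\<close>-th coordinates.\<close>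
  then have kernel: "f k = 0" if "f \<in> S" "f j = 0" for f
    using that by blast
  have S_add: "(\<lambda>i. f i + g i) \<in> S" if "f \<in> S" "g \<in> S" for f g
    using S that unfolding product_submodule_def by blast
  have S_scale: "(\<lambda>i. scale c (f i)) \<in> S" if "f \<in> S" for f c
    using S that unfolding product_submodule_def by blast
  have S_act: "(\<lambda>i. \<rho> i v n (f i)) \<in> S" if "f \<in> S" for f v n
    using S that unfolding product_submodule_def by blast
  have det: "f k = g k" if "f \<in> S" "g \<in> S" "f j = g j" for f g
  proof -
    have "(\<lambda>i. f i + scale (-1) (g i)) \<in> S"
      by (intro S_add S_scale that)
    from kernel[OF this] that show ?thesis by simp
  qed
  define lift where "lift x = (SOME f. f \<in> S \<and> f j = x)" for x
  have lift: "lift x \<in> S \<and> lift x j = x" for x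
    using someI_ex[of "\<lambda>f. f \<in> S \<and> f j = x"]
      product_submodule_projection_surj[OF S irr(1) nz(1), of x]
    unfolding lift_def by blast
  define \<phi> where "\<phi> x = lift x k" for x
  have \<phi>: "\<phi> (f j) = f k" if "f \<in> S" for f
    unfolding \<phi>_def using det lift that by blast
  have \<phi>_add: "\<phi> (x + y) = \<phi> x + \<phi> y" for x y
    using \<phi>[OF S_add[of "lift x" "lift y"]] lift by (simp add: \<phi>_def)
  have \<phi>_scale: "\<phi> (scale c x) = scale c (\<phi> x)" for c x
    using \<phi>[OF S_scale[of "lift x" c]] lift by (simp add: \<phi>_def)
  have \<phi>_act: "\<phi> (\<rho> j v n x) = \<rho> k v n (\<phi> x)" for v n x
    using \<phi>[OF S_act[of "lift x" v n]] lift by (simp add: \<phi>_def)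
  have \<phi>_zero: "\<phi> 0 = 0"
    using \<phi>_scale[of 0 0] by simp
  have surj: "surj \<phi>"
    unfolding surj_def using product_submodule_projection_surj[OF S irr(2) nz(2)] \<phi> by metis
  let ?K = "{x. \<phi> x = 0}"
  have "?K = {0} \<or> ?K = UNIV"
  proof (rule irreducible_under_cases[OF irr(1)])
    show "subspace ?K"
      by (rule subspaceI) (simp_all add: \<phi>_zero \<phi>_add \<phi>_scale)
    show "\<rho> j v n x \<in> ?K" if "x \<in> ?K" for v n x
      using that lin[of v n] by (simp add: \<phi>_act Vector_Spaces.linear_iff) (metis scale_zero_left)
  qed
  moreover have "?K \<noteq> UNIV"
  proof
    assume "?K = UNIV"
    then have "\<phi> x = 0" for x by blast
    with nz(2) surj show False unfolding surj_def by metis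
  qed
  ultimately have K: "?K = {0}" by blast
  have "inj \<phi>"
  proof (rule injI)
    fix x y assume "\<phi> x = \<phi> y"
    moreover have "\<phi> (x + scale (-1) y) = \<phi> x + scale (-1) (\<phi> y)"
      by (simp only: \<phi>_add \<phi>_scale)
    ultimately have "\<phi> (x + scale (-1) y) = 0" by simp
    with K have "x + scale (-1) y = 0" by blast
    then show "x = y" by simp
  qed
  with surj have "bij \<phi>" by (simp add: bij_def)
  moreover have "Vector_Spaces.linear scale scale \<phi>"
    by (simp add: Vector_Spaces.linear_iff \<phi>_add \<phi>_scale vector_space_axioms)
  ultimately have "isomorphic_modules scale (\<rho> j) scale (\<rho> k)"
    unfolding isomorphic_modules_def using \<phi>_act by blast
  with noniso show False by contradiction
qed

lemma product_submodule_vanishing: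
  assumes S: "product_submodule scale \<rho> S"
    and lin: "\<And>i v n. Vector_Spaces.linear scale scale (\<rho> i v n)"
  shows "product_submodule scale \<rho> {f \<in> S. \<forall>j\<in>J. f j = 0}"
proof -
  have "\<rho> i v n 0 = 0" for i v n
    using lin[of i v n] unfolding Vector_Spaces.linear_iff by (metis scale_zero_left)
  then show ?thesis
    using S unfolding product_submodule_def by simp
qed

text \<open>
  The vanishing conditions are imposed one coordinate at a time: the elements that vanish on \<open>J\<close>
  form a submodule again, to which the case of two factors applies.
\<close>

lemma product_submodule_separates:
  assumes S: "product_submodule scale \<rho> S"
    and lin: "\<And>i v n. Vector_Spaces.linear scale scale (\<rho> i v n)"
    and irr: "\<And>i. i \<in> I \<Longrightarrow> irreducible_under scale (\<rho> i) UNIV"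
    and noniso: "\<And>i j. i \<in> I \<Longrightarrow> j \<in> I \<Longrightarrow> i \<noteq> j \<Longrightarrow>
                   \<not> isomorphic_modules scale (\<rho> i) scale (\<rho> j)"
    and nz: "\<And>i. i \<in> I \<Longrightarrow> \<exists>f\<in>S. f i \<noteq> 0"
    and J: "finite J" "J \<subseteq> I" "k \<in> I" "k \<notin> J"
  shows "\<exists>f\<in>S. f k = x \<and> (\<forall>j\<in>J. f j = 0)"
proof -
  have "\<exists>f\<in>S. f k \<noteq> 0 \<and> (\<forall>j\<in>J. f j = 0)"
    using J
  proof (induction J arbitrary: k rule: finite_induct)
    case empty
    then show ?case using nz by auto
  next
    case (insert j J)
    let ?A = "{f \<in> S. \<forall>j\<in>J. f j = 0}"
    have "\<exists>f\<in>?A. f k \<noteq> 0 \<and> f j = 0"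
    proof (rule product_submodule_separates_two)
      show "product_submodule scale \<rho> ?A"
        by (rule product_submodule_vanishing[OF S lin])
      show "\<not> isomorphic_modules scale (\<rho> j) scale (\<rho> k)"
        using insert.prems by (intro noniso) auto
      show "\<exists>f\<in>?A. f j \<noteq> 0" "\<exists>f\<in>?A. f k \<noteq> 0"
        using insert.IH[of j] insert.IH[of k] insert.hyps insert.prems by auto
    qed (use lin irr insert.prems in auto)
    then show ?case by auto
  qed
  then have "\<exists>f\<in>{f \<in> S. \<forall>j\<in>J. f j = 0}. f k \<noteq> 0" by blast
  from product_submodule_projection_surj[OF product_submodule_vanishing[OF S lin] irr[OF J(3)] this]
  show ?thesis by auto
qed

end

section \<open>Associativity in twisted modules\<close>

lemma Sum_any_eventually_eq_sum:
  fixes f :: "nat \<Rightarrow> 'b::comm_monoid_add"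
  assumes "\<forall>\<^sub>F i in sequentially. f i = 0"
  shows "\<forall>\<^sub>F K in sequentially. Sum_any f = (\<Sum>i<K. f i)"
proof -
  obtain K0 where K0: "\<And>i. i \<ge> K0 \<Longrightarrow> f i = 0"
    using assms unfolding eventually_sequentially by blast
  show ?thesis
  proof (rule eventually_sequentiallyI)
    fix K assume "K0 \<le> K"
    then have "{i. f i \<noteq> 0} \<subseteq> {..<K}"
      using K0 by (force simp: not_le[symmetric])
    then show "Sum_any f = (\<Sum>i<K. f i)"
      by (intro Sum_any.expand_superset) auto
  qed
qed

context weak_twisted_module
begin

lemma YM_zero [simp]: "YM 0 n w = 0" "YM v n 0 = 0"
  using YM_linear_left[of n w] YM_linear_right[of v n] unfolding Vector_Spaces.linear_iff
  by (metis V.scale_zero_left M.scale_zero_left)+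

lemma YM_add: "YM (u + v) n w = YM u n w + YM v n w" "YM v n (w + x) = YM v n w + YM v n x"
  using YM_linear_left[of n w] YM_linear_right[of v n] unfolding Vector_Spaces.linear_iff by auto

lemma YM_scale: "YM (scaleV c v) n w = scaleM c (YM v n w)" "YM v n (scaleM c w) = scaleM c (YM v n w)"
  using YM_linear_left[of n w] YM_linear_right[of v n] unfolding Vector_Spaces.linear_iff by auto

lemma YM_sum_left: "YM (\<Sum>x\<in>X. f x) n w = (\<Sum>x\<in>X. YM (f x) n w)"
  by (induction X rule: infinite_finite_induct) (simp_all add: YM_add)

lemma Y_add: "Y (u + u') n v = Y u n v + Y u' n v" "Y u n (v + v') = Y u n v + Y u n v'"
  using Y_linear_left[of n v] Y_linear_right[of u n] unfolding Vector_Spaces.linear_iff by auto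

lemma twist_power_add: "(h ^^ j) (u + v) = (h ^^ j) u + (h ^^ j) v"
proof -
  have "h (x + y) = h x + h y" for x y
    using twist_aut by (simp add: Aut_def Vector_Spaces.linear_iff)
  then show ?thesis by (induction j) simp_all
qed

lemma YM_truncation_eventually: "\<forall>\<^sub>F i in sequentially. YM v (n + of_nat i) w = 0"
proof -
  obtain N where N: "\<And>n. n \<ge> N \<Longrightarrow> YM v n w = 0"
    using YM_truncation by blast
  obtain K where "N - n \<le> of_nat K"
    using real_arch_simple by blast
  then have "YM v (n + of_nat i) w = 0" if "i \<ge> K" for i
    using that by (intro N) (smt (verit) le_diff_eq diff_le_eq add.commute of_nat_le_iff order_trans)
  then show ?thesis by (rule eventually_sequentiallyI)
qed

lemma Y_truncation_eventually: "\<forall>\<^sub>F i in sequentially. Y u (l + int i) v = 0"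
proof -
  obtain N where N: "\<And>n. n \<ge> N \<Longrightarrow> Y u n v = 0"
    using truncation by blast
  show ?thesis
    by (rule eventually_sequentiallyI[of "nat (N - l)"]) (auto intro: N)
qed

text \<open>
  These are the left-hand side of the twisted Jacobi identity without its second term, and the
  right-hand side, both with \<open>m = a/T\<close> and truncated at \<open>K\<close>.  As finite sums they are visibly
  additive in \<open>u\<close> and \<open>v\<close>; for large \<open>K\<close> the truncation loses nothing.
\<close>

definition product_side :: "int \<Rightarrow> int \<Rightarrow> rat \<Rightarrow> nat \<Rightarrow> 'v \<Rightarrow> 'v \<Rightarrow> 'm \<Rightarrow> 'm" where
  "product_side l a n K u v w = (\<Sum>i<K. scaleM ((-1) ^ i * (of_int l gchoose i))
     (YM u (of_int a / of_nat T + of_int l - of_nat i) (YM v (n + of_nat i) w)))"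

definition iterate_side :: "int \<Rightarrow> int \<Rightarrow> rat \<Rightarrow> nat \<Rightarrow> 'v \<Rightarrow> 'v \<Rightarrow> 'm \<Rightarrow> 'm" where
  "iterate_side l a n K u v w =
     scaleM (1 / of_nat T) (\<Sum>j<T. scaleM (\<eta> powi (- (int j * a)))
       (\<Sum>i<K. scaleM (of_rat (of_int a / of_nat T) gchoose i)
         (YM (Y ((h ^^ j) u) (l + int i) v) (of_int a / of_nat T + n - of_nat i) w)))"

lemma product_side_add:
  "product_side l a n K (u + u') v w = product_side l a n K u v w + product_side l a n K u' v w"
  "product_side l a n K u (v + v') w = product_side l a n K u v w + product_side l a n K u v' w"
  by (simp_all add: product_side_def YM_add M.scale_right_distrib sum.distrib)

lemma iterate_side_add:
  "iterate_side l a n K (u + u') v w = iterate_side l a n K u v w + iterate_side l a n K u' v w"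
  "iterate_side l a n K u (v + v') w = iterate_side l a n K u v w + iterate_side l a n K u v' w"
  by (simp_all add: iterate_side_def YM_add Y_add twist_power_add M.scale_right_distrib sum.distrib)

lemma weak_associativity_homogeneous:
  assumes "u \<in> part p" "v \<in> part q" "n = of_int b / of_nat T"
    and ann: "\<And>i. YM u (of_int a / of_nat T + of_nat i) w = 0"
  shows "\<forall>\<^sub>F K in sequentially. product_side l a n K u v w = iterate_side l a n K u v w"
proof -
  let ?m = "of_int a / of_nat T :: rat"
  define P where "P i = scaleM ((-1) ^ i * (of_int l gchoose i))
    (YM u (?m + of_int l - of_nat i) (YM v (n + of_nat i) w))" for i
  define Q where "Q j i = scaleM (of_rat ?m gchoose i)
    (YM (Y ((h ^^ j) u) (l + int i) v) (?m + n - of_nat i) w)" for j i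
  have jac: "Sum_any P = scaleM (1 / of_nat T) (\<Sum>j<T. scaleM (\<eta> powi (- (int j * a))) (Sum_any (Q j)))"
    using twisted_jacobi[OF assms(1,2) refl assms(3), where l = l and w = w and a = a]
    by (simp add: P_def[abs_def] Q_def[abs_def] ann)
  have P: "\<forall>\<^sub>F K in sequentially. Sum_any P = (\<Sum>i<K. P i)"
    by (intro Sum_any_eventually_eq_sum eventually_mono[OF YM_truncation_eventually[of v n w]])
      (simp add: P_def)
  have "\<forall>\<^sub>F K in sequentially. \<forall>j\<in>{..<T}. Sum_any (Q j) = (\<Sum>i<K. Q j i)"
  proof (rule eventually_ball_finite)
    show "\<forall>j\<in>{..<T}. \<forall>\<^sub>F K in sequentially. Sum_any (Q j) = (\<Sum>i<K. Q j i)"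
    proof
      fix j
      show "\<forall>\<^sub>F K in sequentially. Sum_any (Q j) = (\<Sum>i<K. Q j i)"
        by (intro Sum_any_eventually_eq_sum
            eventually_mono[OF Y_truncation_eventually[of "(h ^^ j) u" l v]]) (simp add: Q_def)
    qed
  qed simp
  with P show ?thesis
  proof eventually_elim
    case (elim K)
    then show ?case
      using jac by (simp add: product_side_def iterate_side_def P_def[symmetric] Q_def[symmetric])
  qed
qed

text \<open>
  When \<open>m = a/T\<close> is so large that all modes of \<open>u\<close> from \<open>m\<close> on annihilate \<open>w\<close>, the second term of
  the Jacobi identity vanishes.  With it goes the sign depending on the parities, and what remains
  is additive in \<open>u\<close> and \<open>v\<close>, hence holds for vectors that are not homogeneous.  This generality
  matters because automorphisms may mix the parities.
\<close>

lemma weak_associativity: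
  "\<exists>N::rat. \<forall>a. of_int a / of_nat T \<ge> N \<longrightarrow> (\<forall>l v b.
     \<forall>\<^sub>F K in sequentially. product_side l a (of_int b / of_nat T) K u v w
                          = iterate_side l a (of_int b / of_nat T) K u v w)"
proof -
  obtain u0 u1 where u: "u0 \<in> part 0" "u1 \<in> part 1" "u = u0 + u1"
    using part_decomp by blast
  obtain N0 N1 where N: "\<And>n. n \<ge> N0 \<Longrightarrow> YM u0 n w = 0" "\<And>n. n \<ge> N1 \<Longrightarrow> YM u1 n w = 0"
    using YM_truncation by metis
  have "\<forall>\<^sub>F K in sequentially. product_side l a (of_int b / of_nat T) K u v w
                              = iterate_side l a (of_int b / of_nat T) K u v w"
    if a: "of_int a / of_nat T \<ge> max N0 N1" for a l v b
  proof -
    obtain v0 v1 where v: "v0 \<in> part 0" "v1 \<in> part 1" "v = v0 + v1"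
      using part_decomp by blast
    have ann: "YM u0 (of_int a / of_nat T + of_nat i) w = 0"
      "YM u1 (of_int a / of_nat T + of_nat i) w = 0" for i
      using a by (intro N; simp add: add_increasing2)+
    note hom = weak_associativity_homogeneous[OF _ _ refl, where a = a and b = b and l = l and w = w]
    show ?thesis
      using hom[OF u(1) v(1) ann(1)] hom[OF u(1) v(2) ann(1)]
        hom[OF u(2) v(1) ann(2)] hom[OF u(2) v(2) ann(2)]
      by eventually_elim (simp add: u(3) v(3) product_side_add iterate_side_add)
  qed
  then show ?thesis by blast
qed

end

section \<open>The submodule generated by a diagonal vector\<close>

lemma automorphism_add: "g \<in> carrier (Aut scaleV Y) \<Longrightarrow> g (u + v) = g u + g v"
  and automorphism_scale: "g \<in> carrier (Aut scaleV Y) \<Longrightarrow> g (scaleV c v) = scaleV c (g v)"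
  and automorphism_bij: "g \<in> carrier (Aut scaleV Y) \<Longrightarrow> bij g"
  by (auto simp: Aut_def Vector_Spaces.linear_iff)

lemma automorphism_modes:
  assumes "g \<in> carrier (Aut scaleV Y)"
  shows "g (Y u n v) = Y (g u) n (g v)"
proof -
  have "g \<circ> Y u n \<circ> inv_into UNIV g = Y (g u) n" "bij g"
    using assms by (auto simp: Aut_def)
  then show ?thesis
    by (metis bij_inv_eq_iff comp_apply)
qed

text \<open>
  The vertex operator of \<open>g vac\<close> is the conjugate of the identity by \<open>g\<close>, hence the identity, and the
  creation property recovers \<open>g vac\<close> from it.
\<close>

lemma (in vertex_superalgebra) automorphism_vacuum:
  assumes g: "g \<in> carrier (Aut scaleV Y)"
  shows "g vac = vac"
proof -
  obtain x where x: "g x = vac"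
    using automorphism_bij[OF g] by (metis bij_pointE)
  have "g vac = Y (g vac) (-1) (g x)"
    by (simp add: x creation)
  also have "\<dots> = g x"
    by (simp add: automorphism_modes[OF g, symmetric] vacuum)
  finally show ?thesis by (simp add: x)
qed

lemma inv_in_automorphism_group:
  assumes "vector_space scaleV" "subgroup G (Aut scaleV Y)" "g \<in> G"
  shows "inv_into UNIV g \<in> G"
proof -
  interpret group "Aut scaleV Y"
    by (rule group_Aut) fact
  have g: "g \<in> carrier (Aut scaleV Y)"
    using assms subgroup.subset by blast
  obtain x where x: "x \<in> G" "x \<circ> g = id"
    using subgroup.m_inv_closed[OF assms(2,3)] l_inv[OF g] by (auto simp: Aut_def)
  have "x = inv_into UNIV g"
    using x(2) automorphism_bij[OF g] by (metis bij_is_surj comp_assoc comp_id id_comp surj_iff)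
  with x show ?thesis by simp
qed

text \<open>
  This is the span of the vectors \<open>u_n (w, ..., w)\<close> in the product of the \<open>g \<circ> M\<close>.  A list is enough
  because scalars can be absorbed into \<open>u\<close>.  Only the coordinates in \<open>G\<close> are prescribed; the values
  elsewhere are arbitrary.
\<close>

definition diagonal_submodule ::
  "('v \<Rightarrow> 'v) set \<Rightarrow> ('v \<Rightarrow> rat \<Rightarrow> 'm \<Rightarrow> 'm::ab_group_add) \<Rightarrow> 'm \<Rightarrow> (('v \<Rightarrow> 'v) \<Rightarrow> 'm) set" where
  "diagonal_submodule G YM w =
     {f. \<exists>xs. \<forall>g\<in>G. f g = (\<Sum>(u, n)\<leftarrow>xs. conjugate_action g YM u n w)}"

locale twisted_module_with_group =
  weak_twisted_module scaleV part vac D Y scaleM h T \<eta> YM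
  for scaleV :: "complex \<Rightarrow> 'v::ab_group_add \<Rightarrow> 'v" and part vac D Y
    and scaleM :: "complex \<Rightarrow> 'm::ab_group_add \<Rightarrow> 'm" and h T \<eta> YM +
  fixes G :: "('v \<Rightarrow> 'v) set"
  assumes subgroup_G: "subgroup G (Aut scaleV Y)"
    and finite_G: "finite G"
    and central: "h \<in> center G"
begin

lemma G_automorphism: "g \<in> G \<Longrightarrow> g \<in> carrier (Aut scaleV Y)"
  using subgroup.subset[OF subgroup_G] by blast

lemma inv_in_G: "g \<in> G \<Longrightarrow> inv_into UNIV g \<in> G"
  using inv_in_automorphism_group[OF V.vector_space_axioms subgroup_G] .

lemma inv_automorphism: "g \<in> G \<Longrightarrow> inv_into UNIV g \<in> carrier (Aut scaleV Y)"
  using G_automorphism inv_in_G by blast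

lemma comp_in_G: "g \<in> G \<Longrightarrow> g' \<in> G \<Longrightarrow> g \<circ> g' \<in> G"
  using subgroup.m_closed[OF subgroup_G] by (simp add: Aut_def)

lemma id_in_G: "id \<in> G"
  using subgroup.one_closed[OF subgroup_G] by (simp add: Aut_def)

lemma twist_power_commutes: "g \<in> G \<Longrightarrow> (h ^^ j) (g v) = g ((h ^^ j) v)"
  using central by (induction j) (auto simp: center_def fun_eq_iff)

lemma conjugate_action_linear:
  "Vector_Spaces.linear scaleM scaleM (conjugate_action g YM v n)"
  unfolding conjugate_action_def by (rule YM_linear_right)

lemma conjugate_action_irreducible:
  assumes irr: "irreducible_under scaleM YM UNIV" and g: "g \<in> G"
  shows "irreducible_under scaleM (conjugate_action g YM) UNIV"
proof -
  have "(\<forall>v. P (inv_into UNIV g v)) \<longleftrightarrow> (\<forall>v. P v)" for P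
    using automorphism_bij[OF G_automorphism[OF g]] by (metis bij_inv_eq_iff)
  from this[of "\<lambda>v. \<forall>n. \<forall>w\<in>W. YM v n w \<in> W" for W] irr show ?thesis
    unfolding irreducible_under_def conjugate_action_def by simp
qed

text \<open>Composing everywhere with the automorphism \<open>j\<close> moves the first module back to \<open>M\<close>.\<close>

lemma isomorphic_conjugates:
  assumes "isomorphic_modules scaleM (conjugate_action j YM) scaleM (conjugate_action k YM)"
    and "j \<in> G" "k \<in> G"
  shows "isomorphic_modules scaleM YM scaleM (conjugate_action (inv_into UNIV j \<circ> k) YM)"
proof -
  obtain f where f: "Vector_Spaces.linear scaleM scaleM f" "bij f"
    "\<And>v n w. f (YM (inv_into UNIV j v) n w) = YM (inv_into UNIV k v) n (f w)"
    using assms(1) unfolding isomorphic_modules_def conjugate_action_def by blast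
  have b: "bij j" "bij k"
    using assms automorphism_bij G_automorphism by blast+
  have "inv_into UNIV (inv_into UNIV j \<circ> k) = inv_into UNIV k \<circ> j"
    using b by (simp add: o_inv_distrib bij_imp_bij_inv inv_inv_eq)
  moreover have "f (YM v n w) = YM (inv_into UNIV k (j v)) n (f w)" for v n w
    using f(3)[of "j v"] b by (simp add: bij_is_inj)
  ultimately show ?thesis
    unfolding isomorphic_modules_def conjugate_action_def using f by auto
qed

lemma diagonal_submodule_cong:
  assumes "f \<in> diagonal_submodule G YM w" "\<And>g. g \<in> G \<Longrightarrow> f' g = f g"
  shows "f' \<in> diagonal_submodule G YM w"
  using assms unfolding diagonal_submodule_def by fastforce

lemma diagonal_submodule_generator:
  "(\<lambda>g. conjugate_action g YM u n w) \<in> diagonal_submodule G YM w"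
  unfolding diagonal_submodule_def by (auto intro: exI[of _ "[(u, n)]"])

lemma diagonal_submodule_zero: "(\<lambda>g. 0) \<in> diagonal_submodule G YM w"
  unfolding diagonal_submodule_def by (auto intro: exI[of _ "[]"])

lemma diagonal_submodule_add:
  assumes "f \<in> diagonal_submodule G YM w" "f' \<in> diagonal_submodule G YM w"
  shows "(\<lambda>g. f g + f' g) \<in> diagonal_submodule G YM w"
proof -
  obtain xs ys where "\<forall>g\<in>G. f g = (\<Sum>(u, n)\<leftarrow>xs. conjugate_action g YM u n w)"
    "\<forall>g\<in>G. f' g = (\<Sum>(u, n)\<leftarrow>ys. conjugate_action g YM u n w)"
    using assms unfolding diagonal_submodule_def by blast
  then show ?thesis
    unfolding diagonal_submodule_def by (auto intro!: exI[of _ "xs @ ys"])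
qed

lemma diagonal_submodule_scale:
  assumes "f \<in> diagonal_submodule G YM w"
  shows "(\<lambda>g. scaleM c (f g)) \<in> diagonal_submodule G YM w"
proof -
  obtain xs where xs: "\<forall>g\<in>G. f g = (\<Sum>(u, n)\<leftarrow>xs. conjugate_action g YM u n w)"
    using assms unfolding diagonal_submodule_def by blast
  have "scaleM c (\<Sum>(u, n)\<leftarrow>xs. conjugate_action g YM u n w)
      = (\<Sum>(u, n)\<leftarrow>map (\<lambda>(u, n). (scaleV c u, n)) xs. conjugate_action g YM u n w)"
    if "g \<in> G" for g
    by (induction xs)
      (auto simp: conjugate_action_def M.scale_right_distrib YM_scale
        automorphism_scale[OF inv_automorphism[OF that]])
  with xs have "\<forall>g\<in>G. scaleM c (f g)
      = (\<Sum>(u, n)\<leftarrow>map (\<lambda>(u, n). (scaleV c u, n)) xs. conjugate_action g YM u n w)"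
    by simp
  then show ?thesis
    unfolding diagonal_submodule_def by blast
qed

lemma diagonal_submodule_sum:
  assumes "\<And>i. i \<in> I \<Longrightarrow> f i \<in> diagonal_submodule G YM w"
  shows "(\<lambda>g. \<Sum>i\<in>I. f i g) \<in> diagonal_submodule G YM w"
  using assms
  by (induction I rule: infinite_finite_induct)
    (simp_all add: diagonal_submodule_zero diagonal_submodule_add)

text \<open>
  Here the centrality of \<open>h\<close> enters: \<open>(h^j g^(-1) u)_l (g^(-1) v) = g^(-1) ((h^j u)_l v)\<close>, so every
  summand is a mode of a vector \<open>g^(-1) x\<close> in which \<open>x\<close> is the same for all \<open>g\<close>.
\<close>

lemma iterate_side_in_diagonal_submodule:
  "(\<lambda>g. iterate_side l a n K (inv_into UNIV g u) (inv_into UNIV g v) w) \<in> diagonal_submodule G YM w"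
proof (rule diagonal_submodule_cong)
  show "(\<lambda>g. scaleM (1 / of_nat T) (\<Sum>j<T. scaleM (\<eta> powi (- (int j * a)))
       (\<Sum>i<K. scaleM (of_rat (of_int a / of_nat T) gchoose i)
         (conjugate_action g YM (Y ((h ^^ j) u) (l + int i) v) (of_int a / of_nat T + n - of_nat i) w))))
    \<in> diagonal_submodule G YM w"
    by (intro diagonal_submodule_scale diagonal_submodule_sum diagonal_submodule_generator)
  show "iterate_side l a n K (inv_into UNIV g u) (inv_into UNIV g v) w
    = scaleM (1 / of_nat T) (\<Sum>j<T. scaleM (\<eta> powi (- (int j * a)))
       (\<Sum>i<K. scaleM (of_rat (of_int a / of_nat T) gchoose i)
         (conjugate_action g YM (Y ((h ^^ j) u) (l + int i) v) (of_int a / of_nat T + n - of_nat i) w)))"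
    if "g \<in> G" for g
    by (simp add: iterate_side_def conjugate_action_def twist_power_commutes[OF inv_in_G[OF that]]
        automorphism_modes[OF inv_automorphism[OF that]])
qed

text \<open>
  In the associativity formula take \<open>m = p + k\<close> and \<open>l = -k\<close> with \<open>k\<close> large.  The term \<open>i = 0\<close> of the
  product side is then \<open>u_p v_q w\<close> with coefficient 1, and the other terms have the form
  \<open>u_(p-i) v_(q+i) w\<close> with \<open>i > 0\<close>.  Since \<open>v_q w = 0\<close> for large \<open>q\<close>, this is a downward induction on
  \<open>q\<close>, for all \<open>p\<close> at once.  All bounds have to hold for every \<open>g \<in> G\<close> simultaneously, which is
  possible as \<open>G\<close> is finite.
\<close>

lemma diagonal_submodule_act_generator:
  "(\<lambda>g. conjugate_action g YM u p (conjugate_action g YM v q w)) \<in> diagonal_submodule G YM w"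
proof -
  have "\<forall>g. \<exists>N. \<forall>n\<ge>N. YM (inv_into UNIV g v) n w = 0"
    by (intro allI YM_truncation)
  then obtain N where N: "\<And>g n. n \<ge> N g \<Longrightarrow> YM (inv_into UNIV g v) n w = 0"
    by (auto dest!: choice)
  have "\<forall>g. \<exists>N::rat. \<forall>a. of_int a / of_nat T \<ge> N \<longrightarrow> (\<forall>l v b.
     \<forall>\<^sub>F K in sequentially. product_side l a (of_int b / of_nat T) K (inv_into UNIV g u) v w
                          = iterate_side l a (of_int b / of_nat T) K (inv_into UNIV g u) v w)"
    by (intro allI weak_associativity)
  from choice[OF this] obtain N' where N': "\<And>g a l v b. (of_int a / of_nat T :: rat) \<ge> N' g \<Longrightarrow>
     \<forall>\<^sub>F K in sequentially. product_side l a (of_int b / of_nat T) K (inv_into UNIV g u) v w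
                          = iterate_side l a (of_int b / of_nat T) K (inv_into UNIV g u) v w"
    by blast
  have bound: "\<exists>k::nat. \<forall>g\<in>G. F g \<le> r + of_nat k" for F :: "_ \<Rightarrow> rat" and r
  proof -
    obtain k :: nat where k: "Max (insert 0 (F ` G)) - r \<le> of_nat k"
      using real_arch_simple by blast
    have "F g \<le> Max (insert 0 (F ` G))" if "g \<in> G" for g
      using finite_G that by simp
    with k show ?thesis by (intro exI[of _ k]) force
  qed
  obtain d where d: "\<forall>g\<in>G. N g \<le> q + of_nat d"
    using bound by blast
  then show ?thesis
  proof (induction d arbitrary: p q rule: less_induct)
    case (less d)
    let ?S = "diagonal_submodule G YM w"
    show ?case
    proof (cases "d = 0 \<or> of_nat T * p \<notin> \<int> \<or> of_nat T * q \<notin> \<int>")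
      case True
      then have "conjugate_action g YM u p (conjugate_action g YM v q w) = 0" if "g \<in> G" for g
        using less.prems N that YM_support by (auto simp: conjugate_action_def)
      then show ?thesis
        by (intro diagonal_submodule_cong[OF diagonal_submodule_zero])
    next
      case False
      then obtain a b where "of_nat T * p = of_int a" "of_nat T * q = of_int b"
        by (auto elim!: Ints_cases)
      then have p: "p = of_int a / of_nat T" and q: "q = of_int b / of_nat T"
        using twist_order(2) by (auto simp: field_simps)
      \<comment> \<open>Raising the index by \<open>k\<close> changes \<open>a\<close> by \<open>T k\<close>, so \<open>m\<close> stays in the same class modulo the integers.\<close>
      obtain k where k: "\<forall>g\<in>G. N' g \<le> p + of_nat k"
        using bound by blast
      define a' where "a' = a + int (T * k)"
      have a': "of_int a' / of_nat T = p + of_nat k"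
        using twist_order(2) by (simp add: a'_def p field_simps)
      define l where "l = - int k"
      have "\<forall>\<^sub>F K in sequentially. \<forall>g\<in>G. product_side l a' q K (inv_into UNIV g u) (inv_into UNIV g v) w
                                      = iterate_side l a' q K (inv_into UNIV g u) (inv_into UNIV g v) w"
        unfolding q by (rule eventually_ball_finite[OF finite_G]) (use k N' a' in auto)
      with eventually_gt_at_top[of 0]
      have "\<forall>\<^sub>F K in sequentially. K > 0 \<and> (\<forall>g\<in>G. product_side l a' q K (inv_into UNIV g u) (inv_into UNIV g v) w
                                      = iterate_side l a' q K (inv_into UNIV g u) (inv_into UNIV g v) w)"
        by eventually_elim blast
      then obtain K where K: "K > 0" "\<And>g. g \<in> G \<Longrightarrow>
          product_side l a' q K (inv_into UNIV g u) (inv_into UNIV g v) w = iterate_side l a' q K (inv_into UNIV g u) (inv_into UNIV g v) w"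
        unfolding eventually_sequentially by blast
      define c where "c i = ((-1) ^ i * (of_int l gchoose i) :: complex)" for i
      define f where "f i g = conjugate_action g YM u (p - of_nat i) (conjugate_action g YM v (q + of_nat i) w)"
        for i g
      have f: "f i \<in> ?S" if "i > 0" for i
        unfolding f_def
      proof (rule less.IH)
        show "d - 1 < d" using False by simp
        have "of_nat d \<le> (of_nat i + of_nat (d - 1) :: rat)"
          unfolding of_nat_add[symmetric] of_nat_le_iff using that by simp
        with less.prems show "\<forall>g\<in>G. N g \<le> q + of_nat i + of_nat (d - 1)"
          by force
      qed
      have eq: "f 0 g = iterate_side l a' q K (inv_into UNIV g u) (inv_into UNIV g v) w
          + scaleM (-1) (\<Sum>i\<in>{0<..<K}. scaleM (c i) (f i g))" if "g \<in> G" for g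
      proof -
        have "product_side l a' q K (inv_into UNIV g u) (inv_into UNIV g v) w = (\<Sum>i<K. scaleM (c i) (f i g))"
          unfolding product_side_def a'
          by (simp add: c_def f_def conjugate_action_def l_def)
        also have "{..<K} = insert 0 {0<..<K}"
          using K(1) by auto
        also have "(\<Sum>i\<in>insert 0 {0<..<K}. scaleM (c i) (f i g))
            = f 0 g + (\<Sum>i\<in>{0<..<K}. scaleM (c i) (f i g))"
          by (simp add: c_def)
        finally show ?thesis
          using K(2)[OF that] by (simp add: algebra_simps)
      qed
      have "(\<lambda>g. iterate_side l a' q K (inv_into UNIV g u) (inv_into UNIV g v) w
          + scaleM (-1) (\<Sum>i\<in>{0<..<K}. scaleM (c i) (f i g))) \<in> ?S"
        using f by (intro diagonal_submodule_add diagonal_submodule_scale diagonal_submodule_sum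
            iterate_side_in_diagonal_submodule) auto
      then have "f 0 \<in> ?S"
        by (rule diagonal_submodule_cong) (rule eq)
      then show ?thesis
        by (simp add: f_def[abs_def])
    qed
  qed
qed

lemma diagonal_submodule_act:
  assumes "f \<in> diagonal_submodule G YM w"
  shows "(\<lambda>g. conjugate_action g YM v n (f g)) \<in> diagonal_submodule G YM w"
proof -
  obtain xs where xs: "\<forall>g\<in>G. f g = (\<Sum>(u, n)\<leftarrow>xs. conjugate_action g YM u n w)"
    using assms unfolding diagonal_submodule_def by blast
  have "(\<lambda>g. conjugate_action g YM v n (\<Sum>(u, n)\<leftarrow>xs. conjugate_action g YM u n w))
      \<in> diagonal_submodule G YM w"
  proof (induction xs)
    case Nil
    then show ?case
      using diagonal_submodule_zero by (simp add: conjugate_action_def)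
  next
    case (Cons x xs)
    obtain u q where x: "x = (u, q)" by (cases x)
    have "(\<lambda>g. conjugate_action g YM v n (conjugate_action g YM u q w)
        + conjugate_action g YM v n (\<Sum>(u, n)\<leftarrow>xs. conjugate_action g YM u n w))
        \<in> diagonal_submodule G YM w"
      by (intro diagonal_submodule_add diagonal_submodule_act_generator Cons.IH)
    then show ?case
      by (simp add: x conjugate_action_def YM_add)
  qed
  then show ?thesis
    by (rule diagonal_submodule_cong) (use xs in simp)
qed

lemma diagonal_submodule_is_product_submodule:
  "product_submodule scaleM (\<lambda>g. conjugate_action g YM) (diagonal_submodule G YM w)"
  unfolding product_submodule_def
  by (intro conjI ballI allI diagonal_submodule_zero diagonal_submodule_add
      diagonal_submodule_scale diagonal_submodule_act)

lemma diagonal_in_diagonal_submodule: "(\<lambda>g. w) \<in> diagonal_submodule G YM w"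
  by (rule diagonal_submodule_cong[OF diagonal_submodule_generator[of vac "-1"]])
    (simp add: conjugate_action_def automorphism_vacuum[OF inv_automorphism] YM_vacuum)

section \<open>Averaging over the group\<close>

lemma average_fixed: "(\<Sum>g\<in>G. inv_into UNIV g u) \<in> fixed_points G"
  unfolding fixed_points_def
proof (intro CollectI ballI)
  fix k assume k: "k \<in> G"
  have bij: "bij g" if "g \<in> G" for g
    using that automorphism_bij G_automorphism by blast
  have add: "k (\<Sum>x\<in>X. F x) = (\<Sum>x\<in>X. k (F x))" for F :: "_ \<Rightarrow> 'v" and X
  proof -
    have "k 0 = 0"
      using automorphism_scale[OF G_automorphism[OF k], of 0 0] by simp
    then show ?thesis
      by (induction X rule: infinite_finite_induct)
        (simp_all add: automorphism_add[OF G_automorphism[OF k]])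
  qed
  have "k (\<Sum>g\<in>G. inv_into UNIV g u) = (\<Sum>g\<in>G. inv_into UNIV (g \<circ> inv_into UNIV k) u)"
    using bij k by (simp add: add o_inv_distrib bij_imp_bij_inv inv_inv_eq cong: sum.cong)
  also have "\<dots> = (\<Sum>g\<in>G. inv_into UNIV g u)"
  proof (rule sum.reindex_bij_witness[of _ "\<lambda>g. g \<circ> k" "\<lambda>g. g \<circ> inv_into UNIV k"])
    show "g \<circ> inv_into UNIV k \<circ> k = g" "g \<circ> k \<circ> inv_into UNIV k = g" for g :: "'v \<Rightarrow> 'v"
      using bij[OF k] by (simp_all add: comp_assoc bij_is_inj bij_is_surj surj_iff[symmetric] fun_eq_iff surj_f_inv_f)
  qed (use k in \<open>auto intro: comp_in_G inv_in_G\<close>)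
  finally show "k (\<Sum>g\<in>G. inv_into UNIV g u) = (\<Sum>g\<in>G. inv_into UNIV g u)" .
qed

text \<open>
  On a generator the sum over the coordinates is \<open>(\<Sum>g\<in>G. g^(-1) u)_n w\<close>, a mode of a fixed vector
  applied to \<open>w\<close>.
\<close>

lemma coordinate_sum_in_fixed_submodule:
  assumes W: "M.subspace W" "\<And>v n x. v \<in> fixed_points G \<Longrightarrow> x \<in> W \<Longrightarrow> YM v n x \<in> W"
    and "w \<in> W" "f \<in> diagonal_submodule G YM w"
  shows "(\<Sum>g\<in>G. f g) \<in> W"
proof -
  obtain xs where xs: "\<forall>g\<in>G. f g = (\<Sum>(u, n)\<leftarrow>xs. conjugate_action g YM u n w)"
    using assms(4) unfolding diagonal_submodule_def by blast
  have "(\<Sum>g\<in>G. \<Sum>(u, n)\<leftarrow>xs. conjugate_action g YM u n w) \<in> W"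
  proof (induction xs)
    case Nil
    then show ?case using M.subspace_0[OF W(1)] by simp
  next
    case (Cons x xs)
    obtain u n where x: "x = (u, n)" by (cases x)
    have "(\<Sum>g\<in>G. conjugate_action g YM u n w) = YM (\<Sum>g\<in>G. inv_into UNIV g u) n w"
      by (simp add: conjugate_action_def YM_sum_left)
    also have "\<dots> \<in> W"
      by (rule W(2)[OF average_fixed \<open>w \<in> W\<close>])
    finally show ?case
      using Cons.IH by (simp add: x sum.distrib M.subspace_add[OF W(1)])
  qed
  with xs show ?thesis by (simp cong: sum.cong)
qed

lemma irreducible_under_fixed_points:
  assumes irr: "irreducible_under scaleM YM UNIV"
    and noniso: "\<And>g. g \<in> G - {id} \<Longrightarrow> \<not> isomorphic_modules scaleM YM scaleM (conjugate_action g YM)"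
  shows "irreducible_under scaleM YM (fixed_points G)"
  unfolding irreducible_under_def
proof (intro conjI allI impI)
  show "\<exists>x::'m. x \<noteq> 0"
    using irr unfolding irreducible_under_def by blast
  fix W :: "'m set"
  assume W: "M.subspace W \<and> (\<forall>v\<in>fixed_points G. \<forall>n. \<forall>w\<in>W. YM v n w \<in> W)"
  interpret M': complex_vector_space scaleM ..
  show "W = {0} \<or> W = UNIV"
  proof (rule disjCI)
    assume "W \<noteq> UNIV"
    show "W = {0}"
    proof (rule ccontr)
      assume "W \<noteq> {0}"
      then obtain w where w: "w \<in> W" "w \<noteq> 0"
        using W M.subspace_0 by blast
      have "x \<in> W" for x
      proof -
        have "\<exists>f\<in>diagonal_submodule G YM w. f id = x \<and> (\<forall>g\<in>G - {id}. f g = 0)"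
        proof (rule M'.product_submodule_separates[where I = G])
          show "product_submodule scaleM (\<lambda>g. conjugate_action g YM) (diagonal_submodule G YM w)"
            by (rule diagonal_submodule_is_product_submodule)
          show "\<not> isomorphic_modules scaleM (conjugate_action j YM) scaleM (conjugate_action k YM)"
            if jk: "j \<in> G" "k \<in> G" "j \<noteq> k" for j k
          proof
            assume "isomorphic_modules scaleM (conjugate_action j YM) scaleM (conjugate_action k YM)"
            then have "isomorphic_modules scaleM YM scaleM (conjugate_action (inv_into UNIV j \<circ> k) YM)"
              using jk by (intro isomorphic_conjugates)
            moreover have "inv_into UNIV j \<circ> k \<noteq> id"
            proof
              assume "inv_into UNIV j \<circ> k = id"
              moreover have "bij j"
                using jk automorphism_bij G_automorphism by blast
              ultimately have "k v = j v" for v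
                by (metis bij_inv_eq_iff comp_apply id_apply)
              with jk show False by auto
            qed
            ultimately show False
              using noniso jk by (auto intro: comp_in_G inv_in_G)
          qed
          show "\<exists>f\<in>diagonal_submodule G YM w. f g \<noteq> 0" if "g \<in> G" for g
            using w by (intro bexI[OF _ diagonal_in_diagonal_submodule])
        qed (use conjugate_action_linear conjugate_action_irreducible[OF irr] finite_G id_in_G in auto)
        then obtain f where f: "f \<in> diagonal_submodule G YM w" "f id = x" "\<forall>g\<in>G - {id}. f g = 0"
          by blast
        have "(\<Sum>g\<in>G. f g) = x"
          using f finite_G id_in_G by (simp add: sum.remove)
        moreover have "(\<Sum>g\<in>G. f g) \<in> W"
          using W w f by (intro coordinate_sum_in_fixed_submodule[of W w f]) auto
        ultimately show ?thesis by simp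
      qed
      with \<open>W \<noteq> UNIV\<close> show False by blast
    qed
  qed
qed

end

theorem theorem1:
  fixes scaleV :: "complex \<Rightarrow> 'v::ab_group_add \<Rightarrow> 'v"
    and part :: "bit \<Rightarrow> 'v set"
    and vac :: 'v
    and D :: "'v \<Rightarrow> 'v"
    and Y :: "'v \<Rightarrow> int \<Rightarrow> 'v \<Rightarrow> 'v"
    and G :: "('v \<Rightarrow> 'v) set"
    and h :: "'v \<Rightarrow> 'v"
    and T :: nat
    and \<eta> :: complex
    and scaleM :: "complex \<Rightarrow> 'm::ab_group_add \<Rightarrow> 'm"
    and YM :: "'v \<Rightarrow> rat \<Rightarrow> 'm \<Rightarrow> 'm"
  assumes "vertex_superalgebra scaleV part vac D Y"
    and "countable_dimension scaleV"
    and "subgroup G (Aut scaleV Y)"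
    and "finite G"
    and "h \<in> center G"
    and "weak_twisted_module scaleV part vac D Y scaleM h T \<eta> YM"
    and "irreducible_under scaleM YM UNIV"
    and "\<And>g. g \<in> G - {id} \<Longrightarrow>
           \<not> isomorphic_modules scaleM YM scaleM (conjugate_action g YM)"
  shows "irreducible_under scaleM YM (fixed_points G)"
proof -
  interpret twisted_module_with_group scaleV part vac D Y scaleM h T \<eta> YM G
    using assms by (simp add: twisted_module_with_group_def twisted_module_with_group_axioms_def)
  show ?thesis
    using assms by (intro irreducible_under_fixed_points)
qed

end
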